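(* A $3$-graph $H$ is $\{(4,2),(4,4)\}$-free if and only if every tight component of $H$ is a star.
   Context: A $3$-graph is a pair $H=(V,E)$ with $E\subseteq\binom{V}{3}$. $H$ is $\{(4,2),(4,4)\}$-free if no $4$-vertex subset of $V(H)$ spans exactly $2$ or exactly $4$ edges. A tight walk from an edge $e$ to an edge $e'$ is a sequence of edges $e=f_1,\dots,f_k=e'$ with $|f_i\cap f_{i+1}|=2$ for all $i$. A tight component is a maximal (under inclusion) set $C$ of edges such that any two distinct edges of $C$ are joined by a tight walk. A star $(v,S)$, for a vertex $v$ and a set $S$ not containing $v$, is the set of triples $\{vxy : x,y\in S,\ x\neq y\}$; a tight component is a star if it equals the edge set of some star. *)

theory Defs
  imports Main "HOL-Library.Ramsey"
begin

text \<open>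
  A 3-graph is given by its vertex set \<open>V\<close> and its edge set \<open>E\<close>; \<open>V\<close> may be infinite.
  \<open>[V]\<^bsup>k\<^esup>\<close> is the library's set of \<open>k\<close>-element subsets of \<open>V\<close>.
\<close>

definition three_graph :: "'a set \<Rightarrow> 'a set set \<Rightarrow> bool" where
  "three_graph V E \<longleftrightarrow> E \<subseteq> [V]\<^bsup>3\<^esup>"

definition induced_free :: "(nat \<times> nat) set \<Rightarrow> 'a set \<Rightarrow> 'a set set \<Rightarrow> bool" where
  "induced_free F V E \<longleftrightarrow>
     (\<forall>(m, k) \<in> F. \<not> (\<exists>W \<in> [V]\<^bsup>m\<^esup>. card {e \<in> E. e \<subseteq> W} = k))"

definition tight_walk :: "'a set set \<Rightarrow> 'a set \<Rightarrow> 'a set list \<Rightarrow> 'a set \<Rightarrow> bool" where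
  "tight_walk E e fs e' \<longleftrightarrow>
     fs \<noteq> [] \<and> set fs \<subseteq> E \<and> hd fs = e \<and> last fs = e' \<and>
     (\<forall>i. Suc i < length fs \<longrightarrow> card (fs ! i \<inter> fs ! Suc i) = 2)"

definition tightly_connected :: "'a set set \<Rightarrow> 'a set set \<Rightarrow> bool" where
  "tightly_connected E C \<longleftrightarrow>
     C \<subseteq> E \<and> (\<forall>e \<in> C. \<forall>e' \<in> C. e \<noteq> e' \<longrightarrow> (\<exists>fs. tight_walk E e fs e'))"

text \<open>
  No nonemptiness is imposed: the empty set is a tight component exactly when there are no edges.
\<close>

definition tight_component :: "'a set set \<Rightarrow> 'a set set \<Rightarrow> bool" where
  "tight_component E C \<longleftrightarrow>
     tightly_connected E C \<and> (\<forall>D. tightly_connected E D \<and> C \<subseteq> D \<longrightarrow> D = C)"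

definition star :: "'a \<Rightarrow> 'a set \<Rightarrow> 'a set set" where
  "star v S = {{v, x, y} | x y. x \<in> S \<and> y \<in> S \<and> x \<noteq> y}"

text \<open>
  The centre \<open>v\<close> and the set \<open>S\<close> range over the whole vertex type. For sets of edges of a
  3-graph with at least one vertex this is the same as choosing them inside \<open>V\<close>
  (lemma \<open>is_star_within\<close>); it only matters for the graph with no vertices,
  whose empty tight component then still counts as the star \<open>(v, {})\<close>.
\<close>

definition is_star :: "'a set set \<Rightarrow> bool" where
  "is_star C \<longleftrightarrow> (\<exists>v S. v \<notin> S \<and> C = star v S)"

lemma is_star_within:
  assumes "three_graph V E" "C \<subseteq> E" "V \<noteq> {}"
  shows "is_star C \<longleftrightarrow> (\<exists>v \<in> V. \<exists>S. S \<subseteq> V \<and> v \<notin> S \<and> C = star v S)"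
proof
  assume "is_star C"
  then obtain v S where vS: "v \<notin> S" "C = star v S"
    by (auto simp: is_star_def)
  show "\<exists>v \<in> V. \<exists>S. S \<subseteq> V \<and> v \<notin> S \<and> C = star v S"
  proof (cases "C = {}")
    case True
    obtain w where "w \<in> V" using assms(3) by blast
    with True show ?thesis
      by (intro bexI[of _ w] exI[of _ "{}"]) (auto simp: star_def)
  next
    case False
    have in_V: "v \<in> V \<and> x \<in> V \<and> y \<in> V" if "x \<in> S" "y \<in> S" "x \<noteq> y" for x y
    proof -
      have "{v, x, y} \<in> C" using that vS(2) by (auto simp: star_def)
      then have "{v, x, y} \<subseteq> V"
        using assms(1,2) unfolding three_graph_def nsets_def by blast
      then show ?thesis by simp
    qed
    obtain a b where "a \<in> S" "b \<in> S" "a \<noteq> b"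
      using False vS(2) by (auto simp: star_def)
    then have "v \<in> V" "S \<subseteq> V" using in_V by blast+
    with vS show ?thesis by blast
  qed
next
  assume "\<exists>v \<in> V. \<exists>S. S \<subseteq> V \<and> v \<notin> S \<and> C = star v S"
  then show "is_star C" by (auto simp: is_star_def)
qed

end

theory Submission
  imports Defs
begin

text \<open>
  In a \<open>{(4,2),(4,4)}\<close>-free 3-graph two edges meeting in a pair span a 4-set with exactly three
  edges, so these share a vertex \<open>v\<close>. Comparing the 4-sets inside a 5-set shows that \<open>v\<close> cannot be
  lost along a tight walk, so all edges of the component contain \<open>v\<close>; then the link of \<open>v\<close> in the
  component is a connected graph in which adjacency is transitive, hence a clique. Conversely, two
  edges in a common 4-set lie in one component, and a star meets a 4-set in 0, 1 or 3 edges.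
\<close>

section \<open>Tight components as reachability classes\<close>

definition tight_adj :: "'a set set \<Rightarrow> ('a set \<times> 'a set) set" where
  "tight_adj E = {(e, f). e \<in> E \<and> f \<in> E \<and> card (e \<inter> f) = 2}"

lemma tight_walk_Cons:
  assumes "tight_walk E f fs e'" "(e, f) \<in> tight_adj E"
  shows "tight_walk E e (e # fs) e'"
  using assms by (auto simp: tight_walk_def tight_adj_def nth_Cons hd_conv_nth split: nat.split)

lemma tight_walk_imp_rtrancl: "tight_walk E e fs e' \<Longrightarrow> (e, e') \<in> (tight_adj E)\<^sup>*"
proof (induction fs arbitrary: e)
  case Nil
  then show ?case by (simp add: tight_walk_def)
next
  case (Cons g gs)
  show ?case
  proof (cases "gs = []")
    case True
    with Cons.prems show ?thesis by (auto simp: tight_walk_def)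
  next
    case False
    \<comment> \<open>Index 0 of this fact gives the first step of the walk, index
      \<open>Suc i\<close> the steps of its tail.\<close>
    have adj: "card ((g # gs) ! i \<inter> gs ! i) = 2" if "i < length gs" for i
      using Cons.prems that by (auto simp: tight_walk_def)
    have "card (gs ! i \<inter> gs ! Suc i) = 2" if "Suc i < length gs" for i
      using adj[of "Suc i"] that by simp
    with Cons.prems False have "tight_walk E (hd gs) gs e'"
      by (simp add: tight_walk_def)
    moreover have "card (g \<inter> gs ! 0) = 2"
      using adj[of 0] False by simp
    then have "(e, hd gs) \<in> tight_adj E"
      using Cons.prems False by (auto simp: tight_walk_def tight_adj_def hd_conv_nth)
    ultimately show ?thesis
      using Cons.IH by (meson converse_rtrancl_into_rtrancl)
  qed
qed

text \<open>The hypothesis is needed for the empty path: the closure is reflexive everywhere,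
  whereas a walk consists of edges only.\<close>

lemma ex_tight_walk_iff:
  assumes "e' \<in> E"
  shows "(\<exists>fs. tight_walk E e fs e') \<longleftrightarrow> (e, e') \<in> (tight_adj E)\<^sup>*"
proof
  assume "(e, e') \<in> (tight_adj E)\<^sup>*"
  then show "\<exists>fs. tight_walk E e fs e'"
  proof (induction rule: converse_rtrancl_induct)
    case base
    have "tight_walk E e' [e'] e'"
      using assms by (simp add: tight_walk_def)
    then show ?case ..
  next
    case (step e f)
    then show ?case by (meson tight_walk_Cons)
  qed
qed (auto intro: tight_walk_imp_rtrancl)

lemma sym_rtrancl_tight_adj: "sym ((tight_adj E)\<^sup>*)"
  by (rule sym_rtrancl) (auto simp: sym_def tight_adj_def Int_commute)

lemma rtrancl_tight_adj_in: "(e, f) \<in> (tight_adj E)\<^sup>* \<Longrightarrow> e \<in> E \<Longrightarrow> f \<in> E"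
  by (induction rule: rtrancl_induct) (auto simp: tight_adj_def)

lemma tightly_connected_iff:
  "tightly_connected E C \<longleftrightarrow> C \<subseteq> E \<and> (\<forall>e \<in> C. \<forall>f \<in> C. (e, f) \<in> (tight_adj E)\<^sup>*)"
  unfolding tightly_connected_def
  by (metis ex_tight_walk_iff rtrancl.rtrancl_refl subsetD)

lemma tightly_connected_class:
  assumes "e \<in> E"
  shows "tightly_connected E ((tight_adj E)\<^sup>* `` {e})"
  unfolding tightly_connected_iff
proof (intro conjI ballI subsetI)
  fix f g
  assume "f \<in> (tight_adj E)\<^sup>* `` {e}" "g \<in> (tight_adj E)\<^sup>* `` {e}"
  then show "(f, g) \<in> (tight_adj E)\<^sup>*"
    using symD[OF sym_rtrancl_tight_adj] by (meson Image_singleton_iff rtrancl_trans)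
qed (use assms rtrancl_tight_adj_in in auto)

text \<open>A tightly connected set that contains the class contains \<open>e\<close>, so all its
  members are reachable from \<open>e\<close>.\<close>

lemma tight_component_class:
  assumes "e \<in> E"
  shows "tight_component E ((tight_adj E)\<^sup>* `` {e})"
  unfolding tight_component_def
proof (intro conjI allI impI tightly_connected_class assms)
  fix D
  assume D: "tightly_connected E D \<and> (tight_adj E)\<^sup>* `` {e} \<subseteq> D"
  then have "e \<in> D" by auto
  with D show "D = (tight_adj E)\<^sup>* `` {e}"
    by (auto simp: tightly_connected_iff)
qed

lemma tight_component_eq_class:
  assumes "tight_component E C" "e \<in> C"
  shows "C = (tight_adj E)\<^sup>* `` {e}"
proof -
  have C: "tightly_connected E C"
    using assms(1) by (simp add: tight_component_def)
  then have "C \<subseteq> (tight_adj E)\<^sup>* `` {e}" "e \<in> E"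
    using assms(2) by (auto simp: tightly_connected_iff)
  then show ?thesis
    using assms(1) tightly_connected_class by (metis tight_component_def)
qed

section \<open>Edges inside a 4-set\<close>

text \<open>A tight step becomes an exchange of one vertex \<open>u\<close> for \<open>z\<close>,
  which permits a case analysis on the vertex that is lost.\<close>

lemma tight_adjE:
  assumes "three_graph V E" "(e, f) \<in> tight_adj E"
  obtains u z where "u \<in> e" "z \<notin> e" "f = insert z (e - {u})"
proof -
  have e: "finite e" "card e = 3" and f: "finite f" "card f = 3" and ef: "card (e \<inter> f) = 2"
    using assms by (auto simp: three_graph_def nsets_def tight_adj_def)
  have "card (e - f) = 1" "card (f - e) = 1"
    using e f ef by (auto simp: card_Diff_subset_Int Int_commute)
  then obtain u z where "e - f = {u}" "f - e = {z}"
    by (meson card_1_singletonE)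
  then show ?thesis
    by (intro that[of u z]) auto
qed

lemma three_graph_edgeE:
  assumes "three_graph V E" "e \<in> E"
  obtains a b c where "e = {a, b, c}" "distinct [a, b, c]"
  using assms by (auto simp: three_graph_def nsets_def card_3_iff)

lemma three_graph_distinct:
  assumes "three_graph V E" "{a, b, c} \<in> E"
  shows "distinct [a, b, c]" "{a, b, c} \<subseteq> V"
proof -
  have "card {a, b, c} = 3"
    using assms by (auto simp: three_graph_def nsets_def)
  then show "distinct [a, b, c]" by (auto simp: card_insert_if split: if_splits)
  show "{a, b, c} \<subseteq> V"
    using assms by (auto simp: three_graph_def nsets_def)
qed

lemma triples_of_four:
  assumes "distinct [a, b, c, d]" "e \<subseteq> {a, b, c, d}" "card e = 3"
  shows "e \<in> {{a, b, c}, {a, b, d}, {a, c, d}, {b, c, d}}"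
proof -
  have "card ({a, b, c, d} - e) = 1"
    using assms by (subst card_Diff_subset) (auto simp: finite_subset)
  then obtain u where u: "{a, b, c, d} - e = {u}" by (meson card_1_singletonE)
  then have e: "e = {a, b, c, d} - {u}" and "u \<in> {a, b, c, d}"
    using assms(2) by auto
  then show ?thesis
    using assms(1) by (elim insertE) auto
qed

lemma edges_of_four:
  assumes "three_graph V E" "distinct [a, b, c, d]"
  shows "{e \<in> E. e \<subseteq> {a, b, c, d}} = {{a, b, c}, {a, b, d}, {a, c, d}, {b, c, d}} \<inter> E"
proof -
  have "card e = 3" if "e \<in> E" for e
    using assms(1) that by (auto simp: three_graph_def nsets_def)
  then show ?thesis
    using triples_of_four[OF assms(2)] by blast
qed

lemma card_edges_of_four:
  assumes "three_graph V E" "distinct [a, b, c, d]"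
  shows "card {e \<in> E. e \<subseteq> {a, b, c, d}} =
    of_bool ({a, b, c} \<in> E) + of_bool ({a, b, d} \<in> E) +
    of_bool ({a, c, d} \<in> E) + of_bool ({b, c, d} \<in> E)"
proof -
  have "{a, b, c} \<noteq> {a, b, d}" "{a, b, c} \<noteq> {a, c, d}" "{a, b, c} \<noteq> {b, c, d}"
    "{a, b, d} \<noteq> {a, c, d}" "{a, b, d} \<noteq> {b, c, d}" "{a, c, d} \<noteq> {b, c, d}"
    using assms(2) by auto
  then show ?thesis
    unfolding edges_of_four[OF assms] by (simp add: Int_insert_left)
qed

text \<open>Two of the four triples are edges, so the number of edges is 2, 3 or 4, and only 3 is
  allowed: exactly one of the other two triples is an edge.\<close>

lemma free_third_edge:
  assumes "three_graph V E" "induced_free {(4, 2), (4, 4)} V E"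
    and "distinct [a, b, c, d]" "{a, b, c} \<in> E" "{a, b, d} \<in> E"
  shows "{a, c, d} \<in> E \<longleftrightarrow> {b, c, d} \<notin> E"
proof -
  have "{a, b, c, d} \<in> [V]\<^bsup>4\<^esup>"
    using assms(3) three_graph_distinct(2)[OF assms(1)] assms(4,5) by (auto simp: nsets_def)
  then have "card {e \<in> E. e \<subseteq> {a, b, c, d}} \<notin> {2, 4}"
    using assms(2) by (auto simp: induced_free_def)
  then show ?thesis
    using assms(4,5) by (auto simp: card_edges_of_four[OF assms(1,3)])
qed

text \<open>
  The invariant of the apex \<open>v\<close> along tight walks: without the fourth vertex \<open>w\<close>, a single edge
  would not determine which of its vertices is the apex.
\<close>

definition spans_cone :: "'a set set \<Rightarrow> 'a \<Rightarrow> 'a set \<Rightarrow> bool" where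
  "spans_cone E v e \<longleftrightarrow> (\<exists>x y w. e = {v, x, y} \<and> distinct [v, x, y, w] \<and>
     {v, x, y} \<in> E \<and> {v, x, w} \<in> E \<and> {v, y, w} \<in> E)"

section \<open>Stars in a free 3-graph\<close>

locale free_three_graph =
  fixes V :: "'a set" and E :: "'a set set"
  assumes three_graph: "three_graph V E"
    and free: "induced_free {(4, 2), (4, 4)} V E"
begin

lemmas third_edge = free_third_edge[OF three_graph free]

text \<open>The 4-sets of the five vertices \<open>v\<close>, \<open>x\<close>, \<open>y\<close>,
  \<open>w\<close>, \<open>z\<close> cannot all satisfy the rule for the third edge.\<close>

lemma not_edge_opposite_apex_aux:
  assumes "distinct [v, x, y, w]" "{v, x, y} \<in> E" "{v, x, w} \<in> E" "{v, y, w} \<in> E"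
    and "z \<noteq> v" "{x, y, z} \<in> E" "{v, x, z} \<in> E"
  shows False
proof -
  have "distinct [x, y, z]"
    using three_graph_distinct three_graph assms(6) by metis
  have xyw: "{x, y, w} \<notin> E"
    using third_edge[of v x y w] assms(1-4) by simp
  with assms(6) have "z \<noteq> w" by auto
  have d: "distinct [v, x, y, w, z]"
    using assms(1,5) \<open>distinct [x, y, z]\<close> \<open>z \<noteq> w\<close> by auto
  have vyz: "{v, y, z} \<notin> E"
    using third_edge[of x v y z] assms(2,6,7) d by (auto simp: insert_commute)
  have 1: "{v, w, z} \<in> E \<longleftrightarrow> {x, w, z} \<notin> E"
    using third_edge[of v x w z] assms(3,7) d by (auto simp: insert_commute)
  \<comment> \<open>The first case leaves exactly two edges in \<open>{x, y, z, w}\<close>, the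
    second exactly two in \<open>{v, y, w, z}\<close>.\<close>
  show False
  proof (cases "{v, w, z} \<in> E")
    case True
    then have "{y, w, z} \<in> E"
      using third_edge[of v w y z] assms(4) vyz d by (auto simp: insert_commute)
    then show False
      using third_edge[of y z x w] assms(6) xyw 1 True d by (auto simp: insert_commute)
  next
    case False
    then have xwz: "{x, w, z} \<in> E" using 1 by simp
    then have "{y, w, z} \<in> E"
      using third_edge[of x z y w] assms(6) xyw d by (auto simp: insert_commute)
    then show False
      using third_edge[of y w v z] assms(4) vyz False d by (auto simp: insert_commute)
  qed
qed

text \<open>If \<open>{x, y, z}\<close> were an edge, it would share a pair with
  \<open>{v, x, y}\<close>, so \<open>{v, x, z}\<close> or \<open>{v, y, z}\<close> would be an edge
  too. The cone is symmetric in \<open>x\<close> and \<open>y\<close>, so the previous lemma refutes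
  both cases.\<close>

lemma not_edge_opposite_apex:
  assumes "spans_cone E v {v, x, y}" "z \<noteq> v"
  shows "{x, y, z} \<notin> E"
proof
  assume xyz: "{x, y, z} \<in> E"
  obtain x' y' w where c: "{v, x, y} = {v, x', y'}" "distinct [v, x', y', w]"
    "{v, x', y'} \<in> E" "{v, x', w} \<in> E" "{v, y', w} \<in> E"
    using assms(1) unfolding spans_cone_def by blast
  have "distinct [v, x, y]"
    using three_graph_distinct three_graph c(1,3) by metis
  \<comment> \<open>The cone names its base vertices in some order; a swap of \<open>x\<close> and
    \<open>y\<close> leaves its three edges the same.\<close>
  with c(1,2) have "x' = x \<and> y' = y \<or> x' = y \<and> y' = x"
    by (auto simp: doubleton_eq_iff insert_eq_iff)
  then have e: "distinct [v, x, y, w]" "{v, x, y} \<in> E" "{v, x, w} \<in> E" "{v, y, w} \<in> E"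
    using c by (auto simp: insert_commute)
  have "distinct [x, y, z]"
    using three_graph_distinct three_graph xyz by metis
  then have "{v, x, z} \<in> E \<or> {v, y, z} \<in> E"
    using third_edge[of x y v z] assms(2) xyz e by (auto simp: insert_commute)
  then show False
    using not_edge_opposite_apex_aux[of v x y w z] not_edge_opposite_apex_aux[of v y x w z]
      e xyz assms(2) by (auto simp: insert_commute)
qed

text \<open>In \<open>{v, x, y, z}\<close> the triple opposite \<open>v\<close> is not an edge, so
  \<open>{v, y, z}\<close> must be the third edge. All three edges then contain \<open>v\<close>, so
  \<open>y\<close> serves as fourth vertex for the cone over \<open>{v, x, z}\<close>.\<close>

lemma cone_link_trans:
  assumes "spans_cone E v {v, x, y}" "{v, x, y} \<in> E" "{v, x, z} \<in> E" "y \<noteq> z"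
  shows "{v, y, z} \<in> E" "spans_cone E v {v, x, z}"
proof -
  have d: "distinct [v, x, y, z]"
    using three_graph_distinct(1)[OF three_graph] assms(2-4) by force
  then show vyz: "{v, y, z} \<in> E"
    using third_edge[of v x y z] assms not_edge_opposite_apex[of v x y z] by auto
  have "{v, x, z} = {v, x, z} \<and> distinct [v, x, z, y] \<and>
     {v, x, z} \<in> E \<and> {v, x, y} \<in> E \<and> {v, z, y} \<in> E"
    using d assms vyz by (auto simp: insert_commute)
  then show "spans_cone E v {v, x, z}"
    unfolding spans_cone_def by blast
qed

lemma spans_cone_edge: "spans_cone E v e \<Longrightarrow> e \<in> E"
  by (auto simp: spans_cone_def)

text \<open>The vertex exchanged in a tight step is not the apex, since the new edge would then lie
  opposite it. Transitivity in the link carries the cone over to \<open>f\<close>.\<close>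

lemma spans_cone_step:
  assumes "spans_cone E v e" "(e, f) \<in> tight_adj E"
  obtains x y z where "e = {v, x, y}" "f = {v, x, z}" "y \<noteq> z" "spans_cone E v f"
proof -
  obtain p q where e: "e = {v, p, q}" "distinct [v, p, q]"
    using assms(1) by (auto simp: spans_cone_def)
  obtain u z where uz: "u \<in> e" "z \<notin> e" "f = insert z (e - {u})"
    using tight_adjE[OF three_graph assms(2)] by blast
  have "f \<in> E" using assms(2) by (simp add: tight_adj_def)
  have "u \<noteq> v"
  proof
    assume "u = v"
    with e uz have "f = {p, q, z}" "z \<noteq> v" by auto
    then show False
      using \<open>f \<in> E\<close> not_edge_opposite_apex[of v p q z] assms(1) e(1) by simp
  qed
  then obtain x y where xy: "e = {v, x, y}" "f = {v, x, z}" "y \<noteq> z"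
  proof (cases "u = p")
    case True
    then show ?thesis using e uz by (intro that[of q p]) auto
  next
    case False
    then show ?thesis using e uz \<open>u \<noteq> v\<close> by (intro that[of p q]) auto
  qed
  moreover have "spans_cone E v {v, x, z}"
    using cone_link_trans(2)[of v x y z] assms(1) spans_cone_edge \<open>f \<in> E\<close> xy by simp
  ultimately show ?thesis using that by simp
qed

lemma class_is_star:
  assumes cone: "spans_cone E v {v, a, b}"
  shows "is_star ((tight_adj E)\<^sup>* `` {{v, a, b}})"
proof -
  \<comment> \<open>The closed neighbourhood of \<open>a\<close> in the link of \<open>v\<close>;
    \<open>a\<close> is added by hand because \<open>{v, a, a}\<close> is no edge.\<close>
  define S where "S = insert a {x. {v, a, x} \<in> E}"
  have vab: "{v, a, b} \<in> E" using cone by (rule spans_cone_edge)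
  have v: "v \<notin> S"
    using three_graph_distinct(1)[OF three_graph] vab by (fastforce simp: S_def)
  have vax: "spans_cone E v {v, a, x}" if "{v, a, x} \<in> E" for x
    using cone_link_trans(2)[OF cone vab that] cone by (cases "x = b") auto
  \<comment> \<open>In the link of \<open>v\<close>, \<open>x\<close> is adjacent to both
    \<open>z\<close> and \<open>a\<close>, so transitivity makes \<open>z\<close> adjacent to
    \<open>a\<close>.\<close>
  have S_closed: "z \<in> S" if "spans_cone E v {v, x, z}" "x \<in> S" for x z
  proof (cases "x = a \<or> z = a")
    case True
    then show ?thesis using that spans_cone_edge by (auto simp: S_def)
  next
    case False
    then have "{v, x, a} \<in> E" using that by (auto simp: S_def insert_commute)
    then have "{v, z, a} \<in> E"
      using cone_link_trans(1) that(1) False spans_cone_edge by metis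
    then show ?thesis by (simp add: S_def insert_commute)
  qed
  \<comment> \<open>The cone is part of the induction because it is what keeps \<open>v\<close> in
    the next edge.\<close>
  have reach: "spans_cone E v f \<and> f - {v} \<subseteq> S" if "({v, a, b}, f) \<in> (tight_adj E)\<^sup>*" for f
    using that
  proof (induction rule: rtrancl_induct)
    case base
    then show ?case using cone vab by (auto simp: S_def)
  next
    case (step e f)
    then obtain x y z where e: "e = {v, x, y}" and f: "f = {v, x, z}" "spans_cone E v f"
      using spans_cone_step by metis
    have "distinct [v, x, y]"
      using three_graph_distinct(1)[OF three_graph] e step.IH spans_cone_edge by blast
    then have "x \<in> S" using step.IH e by auto
    moreover have "z \<in> S" using S_closed \<open>x \<in> S\<close> f by simp
    ultimately show ?case using f by auto
  qed
  have adj: "({v, x, y}, {v, x, z}) \<in> (tight_adj E)\<^sup>*" if "{v, x, y} \<in> E" "{v, x, z} \<in> E" for x y z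
  proof (cases "y = z")
    case False
    have "distinct [v, x, y]" "distinct [v, x, z]"
      using three_graph_distinct(1)[OF three_graph] that by blast+
    with False have "{v, x, y} \<inter> {v, x, z} = {v, x}" "v \<noteq> x" by auto
    then have "card ({v, x, y} \<inter> {v, x, z}) = 2" by simp
    then show ?thesis
      using that unfolding tight_adj_def by blast
  qed simp
  have "(tight_adj E)\<^sup>* `` {{v, a, b}} = star v S"
  proof (intro equalityI subsetI)
    fix f
    assume "f \<in> (tight_adj E)\<^sup>* `` {{v, a, b}}"
    then have f: "spans_cone E v f" "f - {v} \<subseteq> S" using reach by auto
    then obtain x y where "f = {v, x, y}" "distinct [v, x, y]"
      by (auto simp: spans_cone_def)
    with f(2) show "f \<in> star v S"
      unfolding star_def by auto
  next
    fix f
    assume "f \<in> star v S"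
    then obtain x y where f: "f = {v, x, y}" "x \<in> S" "y \<in> S" "x \<noteq> y"
      by (auto simp: star_def)
    \<comment> \<open>In the general case the path passes through \<open>{v, a, x}\<close>; the cone
      over this edge makes \<open>{v, x, y}\<close> an edge.\<close>
    have "({v, a, b}, {v, x, y}) \<in> (tight_adj E)\<^sup>*"
    proof (cases "x = a \<or> y = a")
      case True
      then show ?thesis
      proof
        assume "x = a"
        then show ?thesis using adj[OF vab, of y] f by (simp add: S_def)
      next
        assume "y = a"
        then show ?thesis
          using adj[OF vab, of x] f by (simp add: S_def insert_commute[of x a])
      qed
    next
      case False
      then have ax: "{v, a, x} \<in> E" "{v, a, y} \<in> E"
        using f by (auto simp: S_def)
      then have "{v, x, y} \<in> E"
        using cone_link_trans(1)[of v a x y] vax[of x] f(4) by simp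
      then have "({v, x, a}, {v, x, y}) \<in> (tight_adj E)\<^sup>*"
        using adj[of x a y] ax by (simp add: insert_commute)
      then show ?thesis
        using adj[OF vab ax(1)] by (metis insert_commute rtrancl_trans)
    qed
    then show "f \<in> (tight_adj E)\<^sup>* `` {{v, a, b}}" using f(1) by simp
  qed
  with v show ?thesis unfolding is_star_def by blast
qed

text \<open>Starts the invariant. The third edge in \<open>e \<union> f\<close> contains
  \<open>u\<close>, \<open>z\<close> and one of the shared vertices \<open>a\<close>,
  \<open>b\<close>; that shared vertex is the apex and \<open>z\<close> the fourth vertex.\<close>

lemma spans_cone_of_tight_adj:
  assumes "(e, f) \<in> tight_adj E"
  obtains v where "spans_cone E v e"
proof -
  have E: "e \<in> E" "f \<in> E" using assms by (auto simp: tight_adj_def)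
  obtain u z where uz: "u \<in> e" "z \<notin> e" "f = insert z (e - {u})"
    using tight_adjE[OF three_graph assms] by blast
  have "card (e - {u}) = 2"
    using three_graph E(1) uz(1) by (auto simp: three_graph_def nsets_def)
  then obtain a b where "e - {u} = {a, b}" "a \<noteq> b" by (auto simp: card_2_iff)
  with uz(1) have ab: "e = {a, b, u}" "distinct [a, b, u]" by auto
  with uz have f: "f = {a, b, z}" and d: "distinct [a, b, u, z]" by auto
  have "{a, u, z} \<in> E \<or> {b, u, z} \<in> E"
    using third_edge[OF d] E ab f by auto
  then have "spans_cone E a e \<or> spans_cone E b e"
  proof
    assume "{a, u, z} \<in> E"
    then have "e = {a, b, u} \<and> distinct [a, b, u, z] \<and>
     {a, b, u} \<in> E \<and> {a, b, z} \<in> E \<and> {a, u, z} \<in> E"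
      using ab d f E by simp
    then have "spans_cone E a e"
      unfolding spans_cone_def by blast
    then show ?thesis ..
  next
    assume "{b, u, z} \<in> E"
    then have "e = {b, a, u} \<and> distinct [b, a, u, z] \<and>
     {b, a, u} \<in> E \<and> {b, a, z} \<in> E \<and> {b, u, z} \<in> E"
      using ab d f E by (auto simp: insert_commute[of b a])
    then have "spans_cone E b e"
      unfolding spans_cone_def by blast
    then show ?thesis ..
  qed
  then show ?thesis using that by blast
qed

lemma tight_component_is_star:
  assumes "tight_component E C"
  shows "is_star C"
proof (cases "C = {}")
  case True
  then show ?thesis by (auto simp: is_star_def star_def)
next
  case False
  then obtain e where "e \<in> C" by blast
  then have C: "C = (tight_adj E)\<^sup>* `` {e}" by (rule tight_component_eq_class[OF assms])
  have "e \<in> E"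
    using assms \<open>e \<in> C\<close> by (auto simp: tight_component_def tightly_connected_def)
  show ?thesis
  proof (cases "\<exists>f. (e, f) \<in> tight_adj E")
    case True
    then obtain v where cone: "spans_cone E v e"
      using spans_cone_of_tight_adj by blast
    then obtain a b where "e = {v, a, b}" by (auto simp: spans_cone_def)
    then show ?thesis using class_is_star cone C by blast
  next
    \<comment> \<open>An edge without tight neighbours is a component by itself, and a star centred
      at any of its vertices.\<close>
    case False
    then have "C = {e}" unfolding C by (auto elim: converse_rtranclE)
    moreover obtain a b c where "e = {a, b, c}" "distinct [a, b, c]"
      using three_graph_edgeE[OF three_graph \<open>e \<in> E\<close>] by metis
    ultimately have "C = star a {b, c}" "a \<notin> {b, c}"
      by (auto simp: star_def)
    then show ?thesis
      unfolding is_star_def by (intro exI conjI)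
  qed
qed

end

section \<open>Edge counts when all components are stars\<close>

lemma star_memI: "x \<in> S \<Longrightarrow> y \<in> S \<Longrightarrow> x \<noteq> y \<Longrightarrow> {v, x, y} \<in> star v S"
  unfolding star_def by (intro CollectI exI[of _ x] exI[of _ y]) simp

lemma center_in_star_mem: "e \<in> star v S \<Longrightarrow> v \<in> e"
  by (auto simp: star_def)

text \<open>A 4-set with at least two edges has all its edges in one star. Its centre and the other
  three vertices then lie in the 4-set, and the edges are exactly the three triples through the
  centre.\<close>

lemma free_if_components_stars:
  assumes "three_graph V E" and stars: "\<forall>C. tight_component E C \<longrightarrow> is_star C"
  shows "induced_free {(4, 2), (4, 4)} V E"
proof -
  have no: "card {e \<in> E. e \<subseteq> W} \<notin> {2, 4}" if W: "W \<in> [V]\<^bsup>4\<^esup>" for W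
  proof
    assume k: "card {e \<in> E. e \<subseteq> W} \<in> {2, 4}"
    have W4: "finite W" "card W = 4" using W by (auto simp: nsets_def)
    have e3: "card e = 3 \<and> finite e" if "e \<in> E" for e
      using assms(1) that by (auto simp: three_graph_def nsets_def)
    \<comment> \<open>Inclusion-exclusion: the union has at most 4 elements and the intersection at
      most 2, while the sizes add up to 6.\<close>
    have adj: "(e, f) \<in> tight_adj E" and un: "e \<union> f = W"
      if "e \<in> E" "f \<in> E" "e \<subseteq> W" "f \<subseteq> W" "e \<noteq> f" for e f
    proof -
      have "card (e \<union> f) + card (e \<inter> f) = 6"
        using card_Un_Int[of e f] e3 that by simp
      moreover have "card (e \<union> f) \<le> 4"
        using card_mono[of W "e \<union> f"] W4 that by auto
      moreover have "card (e \<inter> f) < 3"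
        using psubset_card_mono[of e "e \<inter> f"] e3[OF that(1)] e3[OF that(2)] that(5)
        by (metis Int_lower1 card_subset_eq inf.absorb_iff1 psubsetI)
      ultimately have "card (e \<inter> f) = 2" "card (e \<union> f) = card W"
        using W4 by auto
      then show "(e, f) \<in> tight_adj E" "e \<union> f = W"
        using that card_subset_eq[of W "e \<union> f"] W4 by (auto simp: tight_adj_def)
    qed
    have "\<exists>e f. e \<in> E \<and> f \<in> E \<and> e \<subseteq> W \<and> f \<subseteq> W \<and> e \<noteq> f"
    proof (rule ccontr)
      assume "\<not> ?thesis"
      then have "card {e \<in> E. e \<subseteq> W} \<le> Suc 0"
        by (subst card_le_Suc0_iff_eq) (use W4 in \<open>auto intro: finite_subset[of _ "Pow W"]\<close>)
      with k show False by auto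
    qed
    then obtain e f where ef: "e \<in> E" "f \<in> E" "e \<subseteq> W" "f \<subseteq> W" "e \<noteq> f" by blast
    obtain v S where vS: "v \<notin> S" "(tight_adj E)\<^sup>* `` {e} = star v S"
      using stars tight_component_class[OF ef(1)] unfolding is_star_def by blast
    have in_star: "g \<in> star v S" if "g \<in> E" "g \<subseteq> W" for g
      using adj[of e g] vS(2) that ef by (cases "g = e") auto
    \<comment> \<open>Every vertex of \<open>W\<close> lies in \<open>e\<close> or \<open>f\<close>,
      both members of the star.\<close>
    have "v \<in> W" "W - {v} \<subseteq> S"
      using in_star[of e] in_star[of f] un[OF ef] ef by (auto simp: star_def)
    have "card (W - {v}) = 3" using W4 \<open>v \<in> W\<close> by simp
    then obtain x y z where xyz: "W - {v} = {x, y, z}" "distinct [x, y, z]"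
      by (auto simp: card_3_iff)
    then have d: "distinct [v, x, y, z]" and Weq: "W = {v, x, y, z}" and "{x, y, z} \<subseteq> S"
      using \<open>v \<in> W\<close> \<open>W - {v} \<subseteq> S\<close> by auto
    have "star v S \<subseteq> E"
      unfolding vS(2)[symmetric] using rtrancl_tight_adj_in[OF _ ef(1)] by blast
    then have "{v, p, q} \<in> E" if "p \<in> S" "q \<in> S" "p \<noteq> q" for p q
      using star_memI[OF that] by (rule subsetD)
    then have "{v, x, y} \<in> E" "{v, x, z} \<in> E" "{v, y, z} \<in> E"
      using d \<open>{x, y, z} \<subseteq> S\<close> by simp_all
    \<comment> \<open>As an edge inside \<open>W\<close> it would belong to the star and contain
      \<open>v\<close>.\<close>
    moreover have "{x, y, z} \<notin> E"
      using center_in_star_mem[OF in_star, of "{x, y, z}"] Weq d by auto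
    ultimately have "card {e \<in> E. e \<subseteq> W} = 3"
      unfolding Weq card_edges_of_four[OF assms(1) d] by simp
    with k show False by simp
  qed
  then show ?thesis unfolding induced_free_def by auto
qed

theorem theorem4p1:
  fixes V :: "'a set" and E :: "'a set set"
  assumes "three_graph V E"
  shows "induced_free {(4, 2), (4, 4)} V E \<longleftrightarrow>
         (\<forall>C. tight_component E C \<longrightarrow> is_star C)"
proof
  assume "induced_free {(4, 2), (4, 4)} V E"
  with assms have "free_three_graph V E" by (rule free_three_graph.intro)
  then show "\<forall>C. tight_component E C \<longrightarrow> is_star C"
    by (intro allI impI free_three_graph.tight_component_is_star)
qed (rule free_if_components_stars[OF assms])

end
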